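(* Let $\mathcal{A}=(A_1,A_2,\dots)$ be a sequence of $d\times d$ matrices with nonnegative entries satisfying condition $\mathbf{(C)}$, and such that $P_n:=A_1\cdots A_n\ne0$ for all $n\ge1$. Then there exists a unique $V\in\mathcal{S}_d$ such that for every $d\times1$ vector $X$ with positive entries, $$\lim_{n\to+\infty}\frac{P_nX}{\|P_nX\|}=V.$$
   Context: Notation. $U_1,\dots,U_d$ are the canonical column vectors, $\|\cdot\|$ is the sum of the moduli of the entries of a vector or matrix, $\mathcal{S}_d$ is the set of nonnegative $d\times1$ vectors of norm $1$. For a column vector $V$, $\mathcal{I}(V):=\{i\;;\;V(i)\ne0\}$ and $\Delta(V):=\sum_{i\in\mathcal{I}(V)}U_i$; inequalities between vectors are entrywise. For a nonnegative matrix $A$ and reals $\lambda\ge0$, $\Lambda\ge1$: $A\in\mathcal{H}_1$ iff for all $j_0,j_1$, $\Delta(AU_{j_0})\ge\Delta(AU_{j_1})$ or $\Delta(AU_{j_0})\le\Delta(AU_{j_1})$; $A\in\mathcal{H}_2(\Lambda)$ iff for all $i_0,j_0$, $A(i_0,j_0)\ne0\Rightarrow\|AU_{j_0}\|\le\Lambda A(i_0,j_0)$; $A\in\mathcal{H}_3(\lambda)$ iff for all $i_0,j_0,j_1$, $[A(i_0,j_0)\ne0$ and $A(i_0,j_1)=0]\Rightarrow\|AU_{j_1}\|\le\lambda A(i_0,j_0)$. Condition $\mathbf{(C)}$. Given $\mathcal{A}=(A_1,A_2,\dots)$ and integers $0=s_0=s_1<s_2<\cdots$, for $n\ge0$ let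 $k\ge0$ be the integer with $s_{k+1}\le n<s_{k+2}$ and put $Q_n:=A_{s_k+1}\cdots A_n$ ($Q_0$ is the identity). $\mathcal{A}$ satisfies condition $\mathbf{(C)}$ if there exist $0\le\lambda<1\le\Lambda<+\infty$ and such a sequence $(s_0,s_1,\dots)$ for which $Q_n\in\mathcal{H}_1\cap\mathcal{H}_2(\Lambda)\cap\mathcal{H}_3(\lambda)$ for every $n\ge s_2$. *)

theory Defs
  imports "HOL-Analysis.Analysis"
begin

text \<open>
  Column vectors are elements of \<open>real ^ 'd\<close> and square matrices elements of
  \<open>real ^ 'd ^ 'd\<close>, with \<open>A $ i $ j\<close> the entry in row \<open>i\<close> and column \<open>j\<close>. The canonical
  column vector \<open>U\<^sub>j\<close> is \<open>axis j 1\<close>. The library order \<open>\<le>\<close> on vectors and matrices is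
  entrywise (but \<open><\<close> is not).
\<close>

definition norm1 :: "real ^ 'd::finite \<Rightarrow> real" where
  "norm1 V = (\<Sum>i\<in>UNIV. \<bar>V $ i\<bar>)"

definition simplex1 :: "(real ^ 'd::finite) set" where
  "simplex1 = {V. 0 \<le> V \<and> norm1 V = 1}"

definition supp_index :: "real ^ 'd::finite \<Rightarrow> 'd set" where
  "supp_index V = {i. V $ i \<noteq> 0}"

definition Delta :: "real ^ 'd::finite \<Rightarrow> real ^ 'd" where
  "Delta V = (\<Sum>i\<in>supp_index V. axis i 1)"

definition H1 :: "(real ^ 'd::finite ^ 'd) set" where
  "H1 = {A. 0 \<le> A \<and> (\<forall>j0 j1.
      Delta (A *v axis j0 1) \<ge> Delta (A *v axis j1 1) \<or>
      Delta (A *v axis j0 1) \<le> Delta (A *v axis j1 1))}"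

definition H2 :: "real \<Rightarrow> (real ^ 'd::finite ^ 'd) set" where
  "H2 Lam = {A. 0 \<le> A \<and> (\<forall>i0 j0.
      A $ i0 $ j0 \<noteq> 0 \<longrightarrow> norm1 (A *v axis j0 1) \<le> Lam * A $ i0 $ j0)}"

definition H3 :: "real \<Rightarrow> (real ^ 'd::finite ^ 'd) set" where
  "H3 lam = {A. 0 \<le> A \<and> (\<forall>i0 j0 j1.
      A $ i0 $ j0 \<noteq> 0 \<and> A $ i0 $ j1 = 0 \<longrightarrow> norm1 (A *v axis j1 1) \<le> lam * A $ i0 $ j0)}"

text \<open>
  Sequences of matrices are indexed from 1; the value at 0 is never used.
  \<open>mprod A m n\<close> is the product of \<open>A i\<close> for \<open>m < i \<le> n\<close>, in increasing order of \<open>i\<close>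
  from left to right, and the identity if \<open>n \<le> m\<close>.
\<close>

definition mprod :: "(nat \<Rightarrow> real ^ 'd::finite ^ 'd) \<Rightarrow> nat \<Rightarrow> nat \<Rightarrow> real ^ 'd ^ 'd" where
  "mprod A m n = foldr (\<lambda>i M. A i ** M) [Suc m..<Suc n] (mat 1)"

definition cut_sequence :: "(nat \<Rightarrow> nat) \<Rightarrow> bool" where
  "cut_sequence s \<longleftrightarrow> s 0 = 0 \<and> s 1 = 0 \<and> (\<forall>k\<ge>1. s k < s (Suc k))"

definition cut_index :: "(nat \<Rightarrow> nat) \<Rightarrow> nat \<Rightarrow> nat" where
  "cut_index s n = (THE k. s (k + 1) \<le> n \<and> n < s (k + 2))"

lemma cut_index_ex1:
  assumes "cut_sequence s"
  shows "\<exists>!k. s (k + 1) \<le> n \<and> n < s (k + 2)"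
proof -
  define t where "t = (\<lambda>k. s (k + 1))"
  have t0: "t 0 = 0" and st: "strict_mono t"
    using assms by (auto simp: t_def cut_sequence_def strict_mono_Suc_iff)
  have "\<exists>k. t k \<le> n \<and> n < t (Suc k)"
  proof (induction n)
    case 0
    then show ?case using t0 strict_monoD[OF st, of 0 1] by auto
  next
    case (Suc n)
    then obtain k where k: "t k \<le> n" "n < t (Suc k)" by blast
    show ?case
    proof (cases "Suc n < t (Suc k)")
      case True
      then show ?thesis using k by (intro exI[of _ k]) auto
    next
      case False
      then show ?thesis
        using k strict_monoD[OF st, of "Suc k" "Suc (Suc k)"]
        by (intro exI[of _ "Suc k"]) auto
    qed
  qed
  moreover have "k = l" if "t k \<le> n" "n < t (Suc k)" "t l \<le> n" "n < t (Suc l)" for k l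
  proof -
    have "t k < t (Suc l)" "t l < t (Suc k)" using that by auto
    then show ?thesis using strict_mono_less[OF st] by (meson less_antisym not_less_eq)
  qed
  ultimately show ?thesis unfolding t_def by auto
qed

definition Qprod :: "(nat \<Rightarrow> real ^ 'd::finite ^ 'd) \<Rightarrow> (nat \<Rightarrow> nat) \<Rightarrow> nat \<Rightarrow> real ^ 'd ^ 'd" where
  "Qprod A s n = mprod A (s (cut_index s n)) n"

definition condition_C :: "(nat \<Rightarrow> real ^ 'd::finite ^ 'd) \<Rightarrow> bool" where
  "condition_C A \<longleftrightarrow> (\<exists>lam Lam s. 0 \<le> lam \<and> lam < 1 \<and> 1 \<le> Lam \<and> cut_sequence s \<and>
      (\<forall>n\<ge>s 2. Qprod A s n \<in> H1 \<inter> H2 Lam \<inter> H3 lam))"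

end

theory Submission
  imports Defs
begin

text \<open>
  Cut the product at the points \<open>t k = s (k + 1)\<close>. Write \<open>P = B\<^sub>0 \<dots> B\<^sub>K\<^sub>-\<^sub>1\<close> for the product of the first
  \<open>K\<close> blocks and \<open>P\<^sub>n = P R\<^sub>n\<close>. Directions of \<open>P\<^sub>n X\<close> are compared, as in the Birkhoff-Hopf theorem, by
  showing that every block contracts the projective distance of a cone by a factor independent
  of the block. The nonnegative orthant will not do, because a block may have zero entries. The cone used
  is \<open>balanced S M\<close>: nonnegative vectors carried by \<open>S\<close> whose entries on \<open>S\<close> are all at least
  \<open>1 / M\<close> times the total mass.

  The conditions \<open>H2\<close> and \<open>H3\<close> enter only through \<open>balanced_image\<close>: a block sends
  \<open>balanced T M\<close> into \<open>balanced S (Lam + lam * M)\<close>, where \<open>S\<close> is the set of rows that meet \<open>T\<close>. As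
  \<open>lam < 1\<close>, the affine map \<open>M \<mapsto> Lam + lam * M\<close> attracts to its fixed point
  \<open>Lam / (1 - lam)\<close>. Hence for \<open>M\<close> twice this fixed point, two things hold. Any positive \<open>X\<close>, however unbalanced,
  enters \<open>balanced S M\<close> after enough blocks (\<open>eventually_balanced\<close>). And each block maps the cone
  strictly inside the next one, with a margin that is the same for all blocks; so if
  \<open>\<alpha> x \<le> y \<le> \<beta> x\<close> in the order of the cone, a block shrinks \<open>\<beta> - \<alpha>\<close> by a fixed factor
  (\<open>sandwich_step\<close>).

  What remains is that \<open>R\<^sub>n X\<close> and \<open>R\<^sub>n\<^sub>' Y\<close> must lie in the same cone, that is, have the same support. The
  support of \<open>R\<^sub>n X\<close> is the set of nonzero rows of \<open>R\<^sub>n\<close>; it decreases with \<open>n\<close>, hence is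
  eventually constant. Therefore, for each \<open>K\<close>, the directions of \<open>P\<^sub>n X\<close> and \<open>P\<^sub>n\<^sub>' Y\<close> are
  exponentially close in \<open>K\<close> once \<open>n\<close> and \<open>n'\<close> are large (\<open>directions_merge\<close>), which gives
  both convergence and independence of \<open>X\<close>.
\<close>

section \<open>Products of consecutive matrices\<close>

lemma mprod_self [simp]: "mprod A m m = mat 1"
  by (simp add: mprod_def)

lemma mprod_Suc:
  assumes "m \<le> n"
  shows "mprod A m (Suc n) = mprod A m n ** A (Suc n)"
proof -
  have shift: "foldr (\<lambda>i M. A i ** M) xs N = foldr (\<lambda>i M. A i ** M) xs (mat 1) ** N" for xs N
    by (induction xs) (simp_all add: matrix_mul_assoc)
  show ?thesis
    using assms shift[of "[Suc m..<Suc n]" "A (Suc n)"] by (simp add: mprod_def)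
qed

lemma mprod_split:
  assumes "m \<le> k" "k \<le> n"
  shows "mprod A m n = mprod A m k ** mprod A k n"
  using assms(2,1)
proof (induction n rule: dec_induct)
  case (step n)
  then show ?case by (simp add: mprod_Suc matrix_mul_assoc)
qed simp

lemma nonneg_matrix_mult:
  fixes A B :: "real ^ 'd::finite ^ 'd"
  assumes "0 \<le> A" "0 \<le> B"
  shows "0 \<le> A ** B"
  using assms by (auto simp: less_eq_vec_def matrix_matrix_mult_def intro!: sum_nonneg)

lemma mprod_nonneg:
  fixes A :: "nat \<Rightarrow> real ^ 'd::finite ^ 'd"
  assumes "\<And>i. m < i \<Longrightarrow> 0 \<le> A i" "m \<le> n"
  shows "0 \<le> mprod A m n"
  using assms(2)
proof (induction n rule: dec_induct)
  case base
  show ?case by (auto simp: less_eq_vec_def mat_def)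
next
  case (step n)
  then show ?case by (simp add: mprod_Suc nonneg_matrix_mult assms)
qed


section \<open>Cones of balanced vectors\<close>

text \<open>
  On nonnegative vectors this is \<open>norm1\<close>; being linear, it makes \<open>balanced\<close> a convex cone.
\<close>
definition mass :: "real ^ 'd::finite \<Rightarrow> real" where
  "mass V = (\<Sum>i\<in>UNIV. V $ i)"

definition balanced :: "'d::finite set \<Rightarrow> real \<Rightarrow> (real ^ 'd) set" where
  "balanced S M = {V. (\<forall>i. 0 \<le> V $ i) \<and> (\<forall>i. i \<notin> S \<longrightarrow> V $ i = 0) \<and> (\<forall>i\<in>S. mass V \<le> M * V $ i)}"

definition hit :: "real ^ 'd::finite ^ 'd \<Rightarrow> 'd set \<Rightarrow> 'd set" where
  "hit A T = {i. \<exists>l\<in>T. A $ i $ l \<noteq> 0}"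

lemma mass_diff: "mass (x - y) = mass x - mass y"
  by (simp add: mass_def sum_subtractf)

lemma mass_scaleR: "mass (a *\<^sub>R x) = a * mass x"
  by (simp add: mass_def sum_distrib_left)

lemma norm1_eq_mass: "(\<And>i. 0 \<le> V $ i) \<Longrightarrow> norm1 V = mass V"
  by (simp add: norm1_def mass_def)

lemma component_le_mass: "(\<And>i. 0 \<le> V $ i) \<Longrightarrow> V $ j \<le> mass V"
  unfolding mass_def by (rule member_le_sum) auto

lemma mass_nonneg: "(\<And>i. 0 \<le> V $ i) \<Longrightarrow> 0 \<le> mass V"
  by (simp add: mass_def sum_nonneg)

lemma mass_pos:
  assumes "\<And>i. 0 \<le> V $ i" "V \<noteq> 0"
  shows "0 < mass V"
proof -
  obtain i where "V $ i \<noteq> 0" using assms(2) by (auto simp: vec_eq_iff)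
  then have "0 < V $ i" using assms(1)[of i] by simp
  then show ?thesis using component_le_mass[of V i, OF assms(1)] by linarith
qed

lemma balanced_nonneg: "V \<in> balanced S M \<Longrightarrow> 0 \<le> V $ i"
  by (simp add: balanced_def)

lemma balanced_mono:
  assumes "V \<in> balanced S m" "m \<le> M"
  shows "V \<in> balanced S M"
  using assms mult_right_mono[OF assms(2)] unfolding balanced_def
  by (blast intro: order_trans)

lemma balanced_scaleR:
  assumes "V \<in> balanced S M" "0 \<le> a"
  shows "a *\<^sub>R V \<in> balanced S M"
  using assms mult_left_mono[OF _ assms(2)]
  by (auto simp: balanced_def mass_scaleR mult.left_commute[of M a])

text \<open>
  Vectors with the better constant \<open>m\<close> are interior to the cone with constant \<open>M\<close>: on \<open>S\<close> the entries of \<open>w\<close>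
  exceed the threshold \<open>mass w / M\<close> by at least \<open>(1 / m - 1 / M) * mass w\<close>, and no entry of
  \<open>t u\<close> is larger than \<open>t * mass u\<close>.
\<close>
lemma balanced_diff:
  assumes w: "w \<in> balanced S m" and u: "u \<in> balanced S m"
    and m: "0 < m" "m < M" and t: "0 \<le> t" "t * mass u \<le> (1 / m - 1 / M) * mass w"
  shows "w - t *\<^sub>R u \<in> balanced S M"
proof -
  have M: "0 < M" using m by simp
  have w0: "0 \<le> w $ i" and u0: "0 \<le> u $ i" for i using w u by (auto simp: balanced_def)
  have mw: "0 \<le> mass w" "0 \<le> mass u" using w0 u0 by (auto intro: mass_nonneg)
  have out: "w $ i = 0" "u $ i = 0" if "i \<notin> S" for i using that w u by (auto simp: balanced_def)
  have key: "t * u $ i + mass w / M \<le> w $ i" if "i \<in> S" for i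
  proof -
    have "mass w / m \<le> w $ i"
      using w that m by (auto simp: balanced_def divide_le_eq mult.commute)
    moreover have "t * u $ i \<le> t * mass u"
      using t component_le_mass[of u i] u0 by (simp add: mult_left_mono)
    moreover have "(1 / m - 1 / M) * mass w = mass w / m - mass w / M"
      by (simp add: left_diff_distrib)
    ultimately show ?thesis using t(2) by linarith
  qed
  have "0 \<le> w $ i - t * u $ i" for i
  proof (cases "i \<in> S")
    case True
    moreover have "0 \<le> mass w / M" using mw M by simp
    ultimately show ?thesis using key[of i] by linarith
  qed (simp add: out)
  moreover have "mass w - t * mass u \<le> M * (w $ i - t * u $ i)" if "i \<in> S" for i
  proof -
    have "mass w = M * (mass w / M)" using M by simp
    also have "\<dots> \<le> M * (w $ i - t * u $ i)"
      using key[OF that] M by (intro mult_left_mono) linarith+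
    moreover have "0 \<le> t * mass u" using t mw by simp
    ultimately show ?thesis by linarith
  qed
  ultimately show ?thesis using out by (auto simp: balanced_def mass_diff mass_scaleR)
qed

lemma matrix_column: "A *v axis j 1 = (\<chi> i. A $ i $ j)" for A :: "real ^ 'd::finite ^ 'd"
  by (simp add: vec_eq_iff matrix_vector_mult_basis column_def)

text \<open>
  Fix a row \<open>i\<close> that meets \<open>T\<close>, say in column \<open>k\<close>. Columns that are nonzero in row \<open>i\<close> have, by \<open>H2\<close>, mass at
  most \<open>Lam\<close> times their entry there, and contribute at most \<open>Lam * (A *v Z) $ i\<close>. The others have
  by \<open>H3\<close> mass at most \<open>lam * A $ i $ k\<close>, and contribute at most
  \<open>lam * A $ i $ k * mass Z\<close>; since \<open>Z\<close> is balanced, \<open>mass Z\<close> is at most \<open>M * Z $ k\<close>.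
\<close>
lemma balanced_image:
  fixes A :: "real ^ 'd::finite ^ 'd"
  assumes A2: "A \<in> H2 Lam" and A3: "A \<in> H3 lam" and lam: "0 \<le> lam"
    and Z: "Z \<in> balanced T M"
  shows "A *v Z \<in> balanced (hit A T) (Lam + lam * M)"
proof -
  have A0: "0 \<le> A $ i $ j" for i j using A2 by (auto simp: H2_def less_eq_vec_def)
  have Z0: "0 \<le> Z $ i" for i using Z by (simp add: balanced_def)
  have out: "Z $ l = 0" if "l \<notin> T" for l using that Z by (simp add: balanced_def)
  define a where "a l = (\<Sum>i\<in>UNIV. A $ i $ l)" for l
  have col: "norm1 (A *v axis l 1) = a l" for l
    by (simp add: matrix_column norm1_def a_def A0)
  have mass: "mass (A *v Z) = (\<Sum>l\<in>UNIV. a l * Z $ l)"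
    unfolding mass_def matrix_vector_mult_def a_def
    by (simp add: sum_distrib_right) (rule sum.swap)
  have nn: "0 \<le> (A *v Z) $ i" for i
    by (simp add: matrix_vector_mult_def sum_nonneg A0 Z0)
  have "(A *v Z) $ i = 0" if "i \<notin> hit A T" for i
    using that out unfolding matrix_vector_mult_def hit_def
    by (auto intro!: sum.neutral) 
  moreover have "mass (A *v Z) \<le> (Lam + lam * M) * (A *v Z) $ i" if "i \<in> hit A T" for i
  proof -
    from that obtain k where k: "k \<in> T" "A $ i $ k \<noteq> 0" by (auto simp: hit_def)
    have one: "a l * Z $ l \<le> Lam * (A $ i $ l * Z $ l) + lam * A $ i $ k * Z $ l" for l
    proof (cases "A $ i $ l = 0")
      case True
      then have "a l \<le> lam * A $ i $ k" using A3 k unfolding H3_def col[symmetric] by blast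
      then show ?thesis using True Z0[of l] by (simp add: mult_right_mono)
    next
      case False
      then have "a l \<le> Lam * A $ i $ l" using A2 unfolding H2_def col[symmetric] by blast
      then have "a l * Z $ l \<le> Lam * (A $ i $ l * Z $ l)"
        unfolding mult.assoc[symmetric] by (rule mult_right_mono) (rule Z0)
      then show ?thesis using lam A0[of i k] Z0[of l] by (simp add: add_increasing2)
    qed
    have "mass (A *v Z) \<le> (\<Sum>l\<in>UNIV. Lam * (A $ i $ l * Z $ l) + lam * A $ i $ k * Z $ l)"
      unfolding mass by (intro sum_mono one)
    also have "\<dots> = Lam * (A *v Z) $ i + lam * A $ i $ k * mass Z"
      by (simp add: sum.distrib mass_def matrix_vector_mult_def sum_distrib_left)
    also have "lam * A $ i $ k * mass Z \<le> lam * A $ i $ k * (M * Z $ k)"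
      using Z k lam A0[of i k] by (intro mult_left_mono) (auto simp: balanced_def)
    also have "\<dots> = lam * M * (A $ i $ k * Z $ k)" by simp
    also have "\<dots> \<le> lam * M * (A *v Z) $ i"
    \<comment> \<open>A negative constant leaves only \<open>Z = 0\<close>, as \<open>T\<close> is nonempty.\<close>
    proof (cases "M \<ge> 0")
      case True
      have "A $ i $ k * Z $ k \<le> (A *v Z) $ i"
        unfolding matrix_vector_mult_def by (simp, rule member_le_sum) (auto simp: A0 Z0)
      then show ?thesis using True lam by (intro mult_left_mono) auto
    next
      case False
      then have "mass Z \<le> 0"
        using Z k Z0[of k] mult_nonpos_nonneg[of M "Z $ k"] by (auto simp: balanced_def)
      then have "Z = 0" using mass_pos[of Z] Z0 by force
      then show ?thesis by simp
    qed
    finally show ?thesis by (simp add: distrib_right)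
  qed
  ultimately show ?thesis using nn by (simp add: balanced_def)
qed


section \<open>Contraction\<close>

text \<open>
  By \<open>balanced_diff\<close> the cone with constant \<open>m\<close> has finite projective diameter in the cone with
  constant \<open>M\<close>; the ratio \<open>\<beta> / \<alpha> = 1 / c\<^sup>2\<close> does not depend on \<open>x\<close> and \<open>y\<close>.
\<close>
lemma sandwich_start:
  assumes x: "x \<in> balanced S m" "x \<noteq> 0" and y: "y \<in> balanced S m" "y \<noteq> 0"
    and m: "0 < m" "m < M" and c: "c = 1 / m - 1 / M" and r: "r = mass y / mass x"
  shows "y - (c * r) *\<^sub>R x \<in> balanced S M" "(r / c) *\<^sub>R x - y \<in> balanced S M"
proof -
  have mp: "0 < mass x" "0 < mass y" using x y by (auto intro!: mass_pos balanced_nonneg)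
  have cp: "0 < c" using m by (simp add: c divide_strict_left_mono)
  have rp: "0 < r" using mp by (simp add: r)
  show "y - (c * r) *\<^sub>R x \<in> balanced S M"
    using cp rp mp by (intro balanced_diff[OF y(1) x(1) m]) (simp_all add: r c[symmetric])
  have "x - (c / r) *\<^sub>R y \<in> balanced S M"
    using cp rp mp by (intro balanced_diff[OF x(1) y(1) m]) (simp_all add: r c[symmetric])
  from balanced_scaleR[OF this, of "r / c"] show "(r / c) *\<^sub>R x - y \<in> balanced S M"
    using cp rp by (simp add: scaleR_diff_right)
qed

text \<open>
  The images of the two differences \<open>y - \<alpha> x\<close> and \<open>\<beta> x - y\<close> have the better constant \<open>m\<close>, so
  \<open>balanced_diff\<close> lets a multiple of \<open>A x\<close> be subtracted from each. The two multiples
  are proportional to the masses of the two images, which add up to \<open>(\<beta> - \<alpha>) * mass (A x)\<close>; this is why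
  the total gain is the fixed fraction \<open>c\<close> of \<open>\<beta> - \<alpha>\<close>.
\<close>
lemma sandwich_step:
  fixes A :: "real ^ 'd::finite ^ 'd"
  assumes A: "A \<in> H2 Lam" "A \<in> H3 lam" and lam: "0 \<le> lam"
    and m: "m = Lam + lam * M" "0 < m" "m < M" and c: "c = 1 / m - 1 / M"
    and x: "x \<in> balanced T M" "A *v x \<noteq> 0"
    and xy: "y - \<alpha> *\<^sub>R x \<in> balanced T M" "\<beta> *\<^sub>R x - y \<in> balanced T M"
  shows "\<exists>\<alpha>' \<beta>'. \<alpha> \<le> \<alpha>' \<and> \<beta>' - \<alpha>' = (1 - c) * (\<beta> - \<alpha>) \<and>
    A *v y - \<alpha>' *\<^sub>R (A *v x) \<in> balanced (hit A T) M \<and>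
    \<beta>' *\<^sub>R (A *v x) - A *v y \<in> balanced (hit A T) M"
proof -
  note image = balanced_image[OF A lam, where M = M, folded m(1)]
  have w: "A *v x \<in> balanced (hit A T) m" by (rule image[OF x(1)])
  have u: "A *v y - \<alpha> *\<^sub>R (A *v x) \<in> balanced (hit A T) m"
    using image[OF xy(1)] by (simp add: matrix_vector_mult_diff_distrib matrix_vector_mult_scaleR)
  have v: "\<beta> *\<^sub>R (A *v x) - A *v y \<in> balanced (hit A T) m"
    using image[OF xy(2)] by (simp add: matrix_vector_mult_diff_distrib matrix_vector_mult_scaleR)
  define p where "p = c * mass (A *v y - \<alpha> *\<^sub>R (A *v x)) / mass (A *v x)"
  define q where "q = c * mass (\<beta> *\<^sub>R (A *v x) - A *v y) / mass (A *v x)"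
  have mw: "0 < mass (A *v x)" using w x(2) by (auto intro!: mass_pos balanced_nonneg)
  have cp: "0 < c" using m by (simp add: c divide_strict_left_mono)
  have p0: "0 \<le> p" "0 \<le> q"
    unfolding p_def q_def using cp mw u v
    by (auto intro!: divide_nonneg_pos mult_nonneg_nonneg mass_nonneg balanced_nonneg)
  have "(A *v y - \<alpha> *\<^sub>R (A *v x)) - p *\<^sub>R (A *v x) \<in> balanced (hit A T) M"
    using mw by (intro balanced_diff[OF u w m(2,3) p0(1)]) (simp add: p_def c[symmetric])
  moreover have "(\<beta> *\<^sub>R (A *v x) - A *v y) - q *\<^sub>R (A *v x) \<in> balanced (hit A T) M"
    using mw by (intro balanced_diff[OF v w m(2,3) p0(2)]) (simp add: q_def c[symmetric])
  moreover have "p + q = c * (\<beta> - \<alpha>)"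
    using mw unfolding p_def q_def by (simp add: mass_diff mass_scaleR field_simps)
  ultimately show ?thesis
    using p0 by (intro exI[of _ "\<alpha> + p"] exI[of _ "\<beta> - q"]) (simp add: algebra_simps)
qed

lemma sandwich_iterate:
  fixes B :: "nat \<Rightarrow> real ^ 'd::finite ^ 'd"
  assumes B: "\<And>k. k < K \<Longrightarrow> B k \<in> H2 Lam" "\<And>k. k < K \<Longrightarrow> B k \<in> H3 lam" and lam: "0 \<le> lam"
    and m: "m = Lam + lam * M" "0 < m" "m < M" and c: "c = 1 / m - 1 / M"
    and x: "\<And>k. k < K \<Longrightarrow> x k = B k *v x (Suc k)" "\<And>k. k < K \<Longrightarrow> x k \<noteq> 0"
    and y: "\<And>k. k < K \<Longrightarrow> y k = B k *v y (Suc k)"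
    and S: "\<And>k. k < K \<Longrightarrow> S k = hit (B k) (S (Suc k))"
    and xK: "x K \<in> balanced (S K) M"
    and xy: "y K - \<alpha> *\<^sub>R x K \<in> balanced (S K) M" "\<beta> *\<^sub>R x K - y K \<in> balanced (S K) M"
  shows "\<exists>\<alpha>' \<beta>'. \<alpha> \<le> \<alpha>' \<and> \<beta>' - \<alpha>' = (1 - c) ^ K * (\<beta> - \<alpha>) \<and>
    y 0 - \<alpha>' *\<^sub>R x 0 \<in> balanced (S 0) M \<and> \<beta>' *\<^sub>R x 0 - y 0 \<in> balanced (S 0) M"
  using B x y S xK xy
proof (induction K arbitrary: \<alpha> \<beta>)
  case 0
  then show ?case by auto
next
  case (Suc K)
  have eq: "x K = B K *v x (Suc K)" "y K = B K *v y (Suc K)" "S K = hit (B K) (S (Suc K))"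
    "x K \<noteq> 0" "B K \<in> H2 Lam" "B K \<in> H3 lam"
    using Suc.prems by blast+
  obtain \<alpha>1 \<beta>1 where 1: "\<alpha> \<le> \<alpha>1" "\<beta>1 - \<alpha>1 = (1 - c) * (\<beta> - \<alpha>)"
    "y K - \<alpha>1 *\<^sub>R x K \<in> balanced (S K) M" "\<beta>1 *\<^sub>R x K - y K \<in> balanced (S K) M"
    using sandwich_step[OF eq(5,6) lam m c Suc.prems(7) _ Suc.prems(8,9)] eq by auto
  have "x K \<in> balanced (S K) M"
    using balanced_image[OF eq(5,6) lam Suc.prems(7)] eq m balanced_mono by fastforce
  then have "\<exists>\<alpha>2 \<beta>2. \<alpha>1 \<le> \<alpha>2 \<and> \<beta>2 - \<alpha>2 = (1 - c) ^ K * (\<beta>1 - \<alpha>1) \<and>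
    y 0 - \<alpha>2 *\<^sub>R x 0 \<in> balanced (S 0) M \<and> \<beta>2 *\<^sub>R x 0 - y 0 \<in> balanced (S 0) M"
    by (intro Suc.IH Suc.prems less_SucI 1(3,4))
  then obtain \<alpha>2 \<beta>2 where "\<alpha>1 \<le> \<alpha>2" "\<beta>2 - \<alpha>2 = (1 - c) ^ K * (\<beta>1 - \<alpha>1)"
    "y 0 - \<alpha>2 *\<^sub>R x 0 \<in> balanced (S 0) M" "\<beta>2 *\<^sub>R x 0 - y 0 \<in> balanced (S 0) M"
    by blast
  then show ?case using 1 by (intro exI[of _ \<alpha>2] exI[of _ \<beta>2]) auto
qed

lemma norm1_triangle: "norm1 (x + y) \<le> norm1 x + norm1 y"
  unfolding norm1_def sum.distrib[symmetric] by (intro sum_mono) (simp add: abs_triangle_ineq)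

lemma norm1_scaleR: "norm1 (a *\<^sub>R x) = \<bar>a\<bar> * norm1 x"
  by (simp add: norm1_def abs_mult sum_distrib_left)

text \<open>
  The remainder \<open>e = y - \<alpha> x\<close> has mass at most \<open>(\<beta> - \<alpha>) * mass x\<close>, whereas \<open>y\<close> has mass
  at least \<open>\<alpha> * mass x\<close>. The factor 2 counts \<open>e\<close> once for itself and once for the change of the
  normalizing factor.
\<close>
lemma normalized_close:
  assumes x: "\<And>i. 0 \<le> x $ i" "x \<noteq> 0" and \<alpha>: "0 < \<alpha>"
    and lo: "\<And>i. 0 \<le> (y - \<alpha> *\<^sub>R x) $ i" and hi: "\<And>i. 0 \<le> (\<beta> *\<^sub>R x - y) $ i"
  shows "norm1 (y /\<^sub>R norm1 y - x /\<^sub>R norm1 x) \<le> 2 * (\<beta> - \<alpha>) / \<alpha>"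
proof -
  define e where "e = y - \<alpha> *\<^sub>R x"
  have y0: "0 \<le> y $ i" for i
    using lo[of i] mult_nonneg_nonneg[OF less_imp_le[OF \<alpha>] x(1)[of i]] by simp
  have nx: "norm1 x = mass x" "norm1 y = mass y" "norm1 e = mass e"
    using x y0 lo by (auto intro: norm1_eq_mass simp: e_def)
  have mx: "0 < mass x" using x by (rule mass_pos)
  have e0: "0 \<le> mass e" using lo unfolding e_def by (rule mass_nonneg)
  have my: "mass y = \<alpha> * mass x + mass e" by (simp add: e_def mass_diff mass_scaleR)
  have "0 \<le> mass (\<beta> *\<^sub>R x - y)" using hi by (rule mass_nonneg)
  then have em: "mass e \<le> (\<beta> - \<alpha>) * mass x"
    by (simp add: e_def mass_diff mass_scaleR algebra_simps)
  have ax: "0 < \<alpha> * mass x" using mx \<alpha> by simp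
  then have myp: "0 < mass y" using my e0 by linarith
  have coeff: "\<alpha> / mass y - 1 / mass x = - (mass e / (mass y * mass x))"
    using mx myp by (simp add: field_simps my)
  have "y /\<^sub>R norm1 y - x /\<^sub>R norm1 x
      = (1 / mass y) *\<^sub>R e + (\<alpha> / mass y - 1 / mass x) *\<^sub>R x"
    by (simp add: nx e_def algebra_simps divide_inverse)
  also have "norm1 \<dots> \<le> norm1 ((1 / mass y) *\<^sub>R e) + norm1 ((\<alpha> / mass y - 1 / mass x) *\<^sub>R x)"
    by (rule norm1_triangle)
  also have "\<dots> = 2 * mass e / mass y"
    unfolding coeff norm1_scaleR nx using mx myp e0 by simp
  also have "\<dots> \<le> 2 * mass e / (\<alpha> * mass x)"
    using my e0 ax myp by (intro divide_left_mono) auto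
  also have "\<dots> \<le> 2 * ((\<beta> - \<alpha>) * mass x) / (\<alpha> * mass x)"
    using em ax by (intro divide_right_mono) auto
  also have "\<dots> = 2 * (\<beta> - \<alpha>) / \<alpha>" using mx by simp
  finally show ?thesis .
qed


section \<open>Supports\<close>

lemma hit_mult:
  fixes A B :: "real ^ 'd::finite ^ 'd"
  assumes "0 \<le> A" "0 \<le> B"
  shows "hit (A ** B) T = hit A (hit B T)"
proof -
  have "(A ** B) $ i $ j \<noteq> 0 \<longleftrightarrow> (\<exists>k. A $ i $ k \<noteq> 0 \<and> B $ k $ j \<noteq> 0)" for i j
    using assms
    by (subst matrix_matrix_mult_def) (simp add: less_eq_vec_def sum_nonneg_eq_0_iff)
  then show ?thesis unfolding hit_def by blast
qed

lemma antimono_finite_sets_stabilize: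
  fixes S :: "nat \<Rightarrow> 'a::finite set"
  assumes "\<And>n. n \<ge> n0 \<Longrightarrow> S (Suc n) \<subseteq> S n"
  shows "\<exists>N\<ge>n0. \<forall>n\<ge>N. S n = S N"
proof -
  obtain N where N: "N \<ge> n0" "\<And>n. n \<ge> n0 \<Longrightarrow> card (S N) \<le> card (S n)"
    using ex_has_least_nat[of "\<lambda>n. n \<ge> n0" n0 "\<lambda>n. card (S n)"] by auto
  have "S n \<subseteq> S N" if "n \<ge> N" for n
    using that
  proof (induction n rule: dec_induct)
    case (step n)
    then show ?case using assms[of n] N(1) by simp
  qed simp
  then have "S n = S N" if "n \<ge> N" for n
    using that N card_seteq[of "S N" "S n"] by auto
  then show ?thesis using N by blast
qed


section \<open>Convergence of directions\<close>

locale block_products =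
  fixes A :: "nat \<Rightarrow> real ^ 'd::finite ^ 'd" and t :: "nat \<Rightarrow> nat" and Lam lam :: real
  assumes nonneg: "\<And>n. n \<ge> 1 \<Longrightarrow> 0 \<le> A n"
    and nonzero: "\<And>n. n \<ge> 1 \<Longrightarrow> mprod A 0 n \<noteq> 0"
    and t0: "t 0 = 0" and mono_t: "strict_mono t"
    and lam: "0 \<le> lam" "lam < 1" and Lam: "1 \<le> Lam"
    and blocks: "\<And>k n. t (k + 1) \<le> n \<Longrightarrow> n < t (k + 2) \<Longrightarrow> mprod A (t k) n \<in> H2 Lam \<inter> H3 lam"
begin

text \<open>
  The constant \<open>wide\<close> is twice the fixed point of \<open>M \<mapsto> Lam + lam * M\<close>. Anything larger than the fixed
  point makes \<open>narrow < wide\<close>; the room is what unbalanced vectors need in order to enter the cone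
  after finitely many blocks.
\<close>
definition wide :: real where "wide = 2 * Lam / (1 - lam)"
definition narrow :: real where "narrow = Lam + lam * wide"
definition gap :: real where "gap = 1 / narrow - 1 / wide"

lemma narrow_less_wide: "0 < narrow" "narrow < wide" and gap_bounds: "0 < gap" "gap < 1"
proof -
  have wide: "0 < wide" using Lam lam by (simp add: wide_def)
  have m1: "1 \<le> narrow" using Lam lam wide by (simp add: narrow_def add_increasing2)
  then show mp: "0 < narrow" by simp
  have "(1 - lam) * wide = 2 * Lam" using lam by (simp add: wide_def)
  then show mM: "narrow < wide" using Lam by (simp add: narrow_def algebra_simps)
  show "0 < gap" using mp mM by (simp add: gap_def divide_strict_left_mono)
  have "1 / narrow \<le> 1" using m1 by simp
  moreover have "0 < 1 / wide" using wide by simp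
  ultimately show "gap < 1" unfolding gap_def by linarith
qed

lemma prod_nonneg: "k \<le> n \<Longrightarrow> 0 \<le> mprod A k n"
  by (rule mprod_nonneg) (auto intro: nonneg)

lemma t_mono: "k \<le> l \<Longrightarrow> t k \<le> t l"
  using mono_t by (simp add: strict_mono_less_eq)

lemma block: "mprod A (t k) (t (Suc k)) \<in> H2 Lam" "mprod A (t k) (t (Suc k)) \<in> H3 lam"
  using blocks[of k "t (Suc k)"] mono_t by (auto simp: strict_mono_less)

lemma prod_step:
  assumes "t (Suc k) \<le> n"
  shows "mprod A (t k) n *v X = mprod A (t k) (t (Suc k)) *v (mprod A (t (Suc k)) n *v X)"
    and "hit (mprod A (t k) n) UNIV
      = hit (mprod A (t k) (t (Suc k))) (hit (mprod A (t (Suc k)) n) UNIV)"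
proof -
  have k: "t k \<le> t (Suc k)" by (simp add: t_mono)
  note eq = mprod_split[OF k assms, of A]
  show "mprod A (t k) n *v X = mprod A (t k) (t (Suc k)) *v (mprod A (t (Suc k)) n *v X)"
    by (simp add: eq matrix_vector_mul_assoc)
  show "hit (mprod A (t k) n) UNIV
      = hit (mprod A (t k) (t (Suc k))) (hit (mprod A (t (Suc k)) n) UNIV)"
    by (simp add: eq hit_mult prod_nonneg k assms)
qed

text \<open>
  Each block applies \<open>M \<mapsto> Lam + lam * M\<close> to the constant, so its excess over the fixed point decays
  geometrically. The last, possibly longer factor \<open>mprod A (t j) n\<close> satisfies the same conditions as a block.
\<close>
lemma balanced_after_blocks:
  assumes X: "X \<in> balanced UNIV M0" and n: "t (j + 1) \<le> n" "n < t (j + 2)" and k: "k \<le> j"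
  shows "mprod A (t k) n *v X
    \<in> balanced (hit (mprod A (t k) n) UNIV) (Lam / (1 - lam) + lam ^ Suc (j - k) * M0)"
  using k
proof (induction k rule: inc_induct)
  case base
  have "mprod A (t j) n *v X \<in> balanced (hit (mprod A (t j) n) UNIV) (Lam + lam * M0)"
    using blocks[OF n] X lam by (intro balanced_image) auto
  moreover have "Lam \<le> Lam / (1 - lam)" using lam Lam by (simp add: field_simps)
  ultimately show ?case by (rule_tac balanced_mono) auto
next
  case (step k)
  have le: "t (Suc k) \<le> n" using n step t_mono[of "Suc k" "j + 1"] by simp
  have "Lam + lam * (Lam / (1 - lam) + lam ^ Suc (j - Suc k) * M0)
      = Lam / (1 - lam) + lam ^ Suc (Suc (j - Suc k)) * M0"
    using lam by (simp add: field_simps)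
  moreover have "Suc (j - Suc k) = j - k" using step by simp
  ultimately show ?case
    using balanced_image[OF block[of k] lam(1) step.IH] by (simp only: prod_step[OF le])
qed

lemma eventually_balanced:
  assumes X: "\<And>i. 0 < X $ i"
  shows "\<exists>N. \<forall>n\<ge>N. mprod A (t k) n *v X \<in> balanced (hit (mprod A (t k) n) UNIV) wide"
proof -
  obtain d where d: "0 < d" "\<And>i. d \<le> X $ i"
  proof
    show "0 < Min (range (($) X))" using X by (subst Min_gr_iff) auto
  qed simp
  define M0 where "M0 = mass X / d"
  have mX: "0 \<le> mass X" by (intro mass_nonneg less_imp_le X)
  then have M0: "0 \<le> M0" using d by (simp add: M0_def)
  have "mass X \<le> M0 * X $ i" for i
  proof -
    have "mass X = M0 * d" using d by (simp add: M0_def)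
    also have "\<dots> \<le> M0 * X $ i" using M0 d by (intro mult_left_mono) auto
    finally show ?thesis .
  qed
  then have Xb: "X \<in> balanced UNIV M0" using X by (auto simp: balanced_def intro: less_imp_le)
  have Lp: "0 < Lam / (1 - lam)" using lam Lam by simp
  have "(\<lambda>j. lam ^ j * M0) \<longlonglongrightarrow> 0 * M0"
    using lam by (intro tendsto_intros LIMSEQ_realpow_zero)
  then have "\<forall>\<^sub>F j in sequentially. lam ^ j * M0 < Lam / (1 - lam)"
    using Lp by (intro order_tendstoD) auto
  then obtain J where J: "\<And>j. j \<ge> J \<Longrightarrow> lam ^ j * M0 < Lam / (1 - lam)"
    by (auto simp: eventually_sequentially)
  have "mprod A (t k) n *v X \<in> balanced (hit (mprod A (t k) n) UNIV) wide" if n: "n \<ge> t (k + J + 1)" for n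
  proof -
    \<comment> \<open>The greatest \<open>j\<close> with \<open>P j\<close> is the index of the interval between cuts that contains \<open>n\<close>.\<close>
    define P where "P j \<longleftrightarrow> t (Suc j) \<le> n" for j
    have "P (k + J)" using n by (simp add: P_def)
    moreover have bound: "j \<le> n" if "P j" for j
      using that seq_suble[OF mono_t, of "Suc j"] by (simp add: P_def)
    ultimately have j: "P (Greatest P)" "k + J \<le> Greatest P"
      by (auto intro: GreatestI_nat Greatest_le_nat)
    have "\<not> P (Suc (Greatest P))"
      using Greatest_le_nat[of P "Suc (Greatest P)" n] bound by auto
    with j have jj: "t (Greatest P + 1) \<le> n" "n < t (Greatest P + 2)" by (auto simp: P_def)
    have "lam ^ Suc (Greatest P - k) * M0 < Lam / (1 - lam)" using j by (intro J) simp
    then have "Lam / (1 - lam) + lam ^ Suc (Greatest P - k) * M0 \<le> wide"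
      unfolding wide_def by simp
    then show ?thesis
      using balanced_mono[OF balanced_after_blocks[OF Xb jj, of k]] j by simp
  qed
  then show ?thesis by blast
qed

lemma supports_stabilize:
  "\<exists>N. \<forall>n\<ge>N. \<forall>n'\<ge>N. hit (mprod A (t k) n) UNIV = hit (mprod A (t k) n') UNIV"
proof -
  have "hit (mprod A (t k) (Suc n)) UNIV \<subseteq> hit (mprod A (t k) n) UNIV" if "n \<ge> t k" for n
    using that prod_nonneg nonneg by (simp add: mprod_Suc hit_mult) (auto simp: hit_def)
  from antimono_finite_sets_stabilize[of "t k" "\<lambda>n. hit (mprod A (t k) n) UNIV", OF this]
  show ?thesis by metis
qed

lemma prod_pos_nonneg:
  assumes "\<And>i. 0 < X $ i" "k \<le> n"
  shows "0 \<le> (mprod A k n *v X) $ i"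
  using prod_nonneg[OF assms(2)] assms(1)
  by (auto simp: matrix_vector_mult_def less_eq_vec_def intro!: sum_nonneg mult_nonneg_nonneg intro: less_imp_le)

lemma prod_pos_nonzero:
  assumes X: "\<And>i. 0 < X $ i" and n: "n \<ge> 1"
  shows "mprod A 0 n *v X \<noteq> 0"
proof
  assume 0: "mprod A 0 n *v X = 0"
  have P: "0 \<le> mprod A 0 n $ i $ j" for i j
    using prod_nonneg[of 0 n] by (simp add: less_eq_vec_def)
  have "mprod A 0 n $ i $ j * X $ j = 0" for i j
  proof -
    have "(\<Sum>j\<in>UNIV. mprod A 0 n $ i $ j * X $ j) = 0"
      using arg_cong[OF 0, of "\<lambda>v. v $ i"] by (simp add: matrix_vector_mult_def)
    then show ?thesis
      by (subst (asm) sum_nonneg_eq_0_iff) (auto simp: P X less_imp_le)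
  qed
  then have "mprod A 0 n = 0" using X by (auto simp: vec_eq_iff) (metis less_irrefl)
  then show False using nonzero n by blast
qed

definition direction :: "real ^ 'd \<Rightarrow> nat \<Rightarrow> real ^ 'd" where
  "direction X n = (mprod A 0 n *v X) /\<^sub>R norm1 (mprod A 0 n *v X)"

text \<open>
  At level \<open>Suc K\<close> the two vectors are balanced with equal supports. The block from level \<open>Suc K\<close> to
  level \<open>K\<close> makes them \<open>narrow\<close>, which gives the initial comparison; the \<open>K\<close> remaining blocks contract it.
\<close>
lemma directions_merge:
  assumes X: "\<And>i. 0 < X $ i" and Y: "\<And>i. 0 < Y $ i" and e: "0 < e"
  shows "\<exists>N. \<forall>n\<ge>N. \<forall>n'\<ge>N. norm1 (direction Y n' - direction X n) < e"
proof -
  have "(\<lambda>K. 2 * (1 - gap) ^ K / gap\<^sup>2) \<longlonglongrightarrow> 2 * 0 / gap\<^sup>2"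
    using gap_bounds by (intro tendsto_intros LIMSEQ_realpow_zero) auto
  then have "\<forall>\<^sub>F K in sequentially. 2 * (1 - gap) ^ K / gap\<^sup>2 < e"
    using e by (intro order_tendstoD) auto
  then obtain K where K: "2 * (1 - gap) ^ K / gap\<^sup>2 < e"
    by (auto simp: eventually_sequentially)
  obtain N1 where N1: "\<And>n. n \<ge> N1 \<Longrightarrow>
      mprod A (t (Suc K)) n *v X \<in> balanced (hit (mprod A (t (Suc K)) n) UNIV) wide"
    using eventually_balanced[of X "Suc K"] X by blast
  obtain N2 where N2: "\<And>n. n \<ge> N2 \<Longrightarrow>
      mprod A (t (Suc K)) n *v Y \<in> balanced (hit (mprod A (t (Suc K)) n) UNIV) wide"
    using eventually_balanced[of Y "Suc K"] Y by blast
  obtain N3 where N3: "\<And>n n'. n \<ge> N3 \<Longrightarrow> n' \<ge> N3 \<Longrightarrow>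
      hit (mprod A (t (Suc K)) n) UNIV = hit (mprod A (t (Suc K)) n') UNIV"
    using supports_stabilize[of "Suc K"] by blast
  define N where "N = Max {1, N1, N2, N3, t (Suc K)}"
  have "norm1 (direction Y n' - direction X n) < e" if "n \<ge> N" "n' \<ge> N" for n n'
  proof -
    have n: "n \<ge> 1" "n \<ge> N1" "n \<ge> N3" "n \<ge> t (Suc K)"
      and n': "n' \<ge> 1" "n' \<ge> N2" "n' \<ge> N3" "n' \<ge> t (Suc K)"
      using that by (auto simp: N_def)
    define B where "B k = mprod A (t k) (t (Suc k))" for k
    define S where "S k = hit (mprod A (t k) n) UNIV" for k
    define x where "x k = mprod A (t k) n *v X" for k
    define y where "y k = mprod A (t k) n' *v Y" for k
    have le: "t (Suc k) \<le> n" "t (Suc k) \<le> n'" if "k \<le> K" for k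
      using that n n' t_mono[of "Suc k" "Suc K"] by auto
    have steps: "x k = B k *v x (Suc k)" "y k = B k *v y (Suc k)" "S k = hit (B k) (S (Suc k))"
      if "k \<le> K" for k
      unfolding x_def y_def S_def B_def using prod_step[OF le(1)[OF that]] prod_step[OF le(2)[OF that]]
      by blast+
    have nz: "x k \<noteq> 0 \<and> y k \<noteq> 0" if "k \<le> K" for k
      using that
    proof (induction k)
      case 0
      then show ?case using prod_pos_nonzero[of X n] prod_pos_nonzero[of Y n'] X Y n n'
        by (simp add: x_def y_def t0)
    next
      case (Suc k)
      then show ?case using steps[of k] by auto
    qed
    have top: "x (Suc K) \<in> balanced (S (Suc K)) wide" "y (Suc K) \<in> balanced (S (Suc K)) wide"
      using N1[of n] N2[of n'] N3[of n n'] n n' by (simp_all add: x_def y_def S_def)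
    have xyK: "x K \<in> balanced (S K) narrow" "y K \<in> balanced (S K) narrow"
      using balanced_image[OF block[of K] lam(1) top(1)] balanced_image[OF block[of K] lam(1) top(2)]
      by (simp_all add: steps B_def narrow_def)
    define r where "r = mass (y K) / mass (x K)"
    have rp: "0 < r"
      using nz[of K] xyK by (auto simp: r_def intro!: divide_pos_pos mass_pos balanced_nonneg)
    note start = sandwich_start[OF xyK(1) _ xyK(2) _ narrow_less_wide gap_def r_def]
    have "\<exists>\<alpha> \<beta>. gap * r \<le> \<alpha> \<and> \<beta> - \<alpha> = (1 - gap) ^ K * (r / gap - gap * r) \<and>
        y 0 - \<alpha> *\<^sub>R x 0 \<in> balanced (S 0) wide \<and> \<beta> *\<^sub>R x 0 - y 0 \<in> balanced (S 0) wide"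
    proof (rule sandwich_iterate[where B = B, OF _ _ lam(1) narrow_def narrow_less_wide gap_def])
      show "B k \<in> H2 Lam" "B k \<in> H3 lam" for k by (simp_all add: B_def block)
      show "x K \<in> balanced (S K) wide"
        using balanced_mono[OF xyK(1)] narrow_less_wide by simp
          show "x k = B k *v x (Suc k)" "y k = B k *v y (Suc k)" "S k = hit (B k) (S (Suc k))"
        if "k < K" for k
        using steps[of k] that by simp_all
    qed (use nz start in simp_all)
    then obtain \<alpha> \<beta> where ab: "gap * r \<le> \<alpha>" "\<beta> - \<alpha> = (1 - gap) ^ K * (r / gap - gap * r)"
      "y 0 - \<alpha> *\<^sub>R x 0 \<in> balanced (S 0) wide" "\<beta> *\<^sub>R x 0 - y 0 \<in> balanced (S 0) wide"
      by blast
    have cr: "0 < gap * r" using gap_bounds rp by simp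
    have eq: "direction Y n' = y 0 /\<^sub>R norm1 (y 0)" "direction X n = x 0 /\<^sub>R norm1 (x 0)"
      by (simp_all add: direction_def x_def y_def t0)
    have "norm1 (direction Y n' - direction X n) \<le> 2 * (\<beta> - \<alpha>) / \<alpha>"
      unfolding eq
    proof (rule normalized_close)
      show "0 \<le> x 0 $ i" for i using prod_pos_nonneg[of X 0 n i] X by (simp add: x_def t0)
    qed (use nz[of 0] ab cr in \<open>auto dest: balanced_nonneg simp del: vector_minus_component\<close>)
    also have "\<dots> \<le> 2 * ((1 - gap) ^ K * (r / gap)) / (gap * r)"
    proof (rule frac_le)
      show "2 * (\<beta> - \<alpha>) \<le> 2 * ((1 - gap) ^ K * (r / gap))"
        unfolding ab(2) using cr gap_bounds
          by (intro mult_left_mono) (auto intro: mult_left_mono simp del: times_divide_eq_right)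
      show "0 \<le> 2 * ((1 - gap) ^ K * (r / gap))" using rp gap_bounds by simp
    qed (use ab cr in auto)
    also have "\<dots> = 2 * (1 - gap) ^ K / gap\<^sup>2" using rp by (simp add: power2_eq_square)
    also have "\<dots> < e" by (rule K)
    finally show ?thesis .
  qed
  then show ?thesis by blast
qed

lemma direction_in_simplex:
  assumes "\<And>i. 0 < X $ i" "n \<ge> 1"
  shows "direction X n \<in> simplex1"
proof -
  have "0 < norm1 (mprod A 0 n *v X)"
    using assms prod_pos_nonneg prod_pos_nonzero
    by (subst norm1_eq_mass) (auto intro!: mass_pos)
  then show ?thesis
    using assms prod_pos_nonneg
    by (simp add: simplex1_def direction_def norm1_scaleR less_eq_vec_def)
qed

lemma directions_converge:
  "\<exists>!V. V \<in> simplex1 \<and> (\<forall>X. (\<forall>i. 0 < X $ i) \<longrightarrow> direction X \<longlonglongrightarrow> V)"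
proof -
  have norm_le: "norm v \<le> norm1 v" for v :: "real ^ 'd"
    unfolding norm1_def by (rule norm_le_l1_cart)
  define E :: "real ^ 'd" where "E = (\<chi> i. 1)"
  have E: "0 < E $ i" for i by (simp add: E_def)
  have "Cauchy (direction E)"
    unfolding Cauchy_iff using directions_merge[OF E E] norm_le by (meson le_less_trans)
  then obtain V where V: "direction E \<longlonglongrightarrow> V" using Cauchy_convergent_iff convergent_def by blast
  have "direction X \<longlonglongrightarrow> V" if X: "\<forall>i. 0 < X $ i" for X
  proof -
    have "(\<lambda>n. direction X n - direction E n) \<longlonglongrightarrow> 0"
      unfolding LIMSEQ_iff using directions_merge[OF E, of X] X norm_le
      by (simp, meson le_less_trans)
    from tendsto_add[OF this V] show ?thesis by simp
  qed
  moreover have "V \<in> simplex1"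
  proof -
    have ev: "\<forall>\<^sub>F n in sequentially. direction E n \<in> simplex1"
      using direction_in_simplex[OF E] by (auto simp: eventually_sequentially)
    have "closed (simplex1 :: (real ^ 'd) set)"
    proof -
      have "simplex1 = (\<Inter>i. {V :: real ^ 'd. 0 \<le> V $ i}) \<inter> {V. (\<Sum>i\<in>UNIV. \<bar>V $ i\<bar>) = 1}"
        by (auto simp: simplex1_def norm1_def less_eq_vec_def)
      also have "closed \<dots>"
        by (intro closed_Int closed_INT ballI closed_Collect_le closed_Collect_eq continuous_intros)
      finally show ?thesis .
    qed
    from Lim_in_closed_set[OF this ev _ V] show ?thesis by simp
  qed
  ultimately show ?thesis using E LIMSEQ_unique by blast
qed

end

theorem corollaryA:
  fixes A :: "nat \<Rightarrow> real ^ 'd::finite ^ 'd"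
  assumes nonneg: "\<And>n. n \<ge> 1 \<Longrightarrow> 0 \<le> A n"
    and C: "condition_C A"
    and nonzero: "\<And>n. n \<ge> 1 \<Longrightarrow> mprod A 0 n \<noteq> 0"
  shows "\<exists>!V. V \<in> simplex1 \<and>
    (\<forall>X :: real ^ 'd. (\<forall>i. 0 < X $ i) \<longrightarrow>
      (\<lambda>n. (mprod A 0 n *v X) /\<^sub>R norm1 (mprod A 0 n *v X)) \<longlonglongrightarrow> V)"
proof -
  obtain lam Lam s where lam: "0 \<le> lam" "lam < 1" and Lam: "1 \<le> Lam" and s: "cut_sequence s"
    and Q: "\<And>n. n \<ge> s 2 \<Longrightarrow> Qprod A s n \<in> H1 \<inter> H2 Lam \<inter> H3 lam"
    using C unfolding condition_C_def by blast
  have mono: "strict_mono (\<lambda>k. s (Suc k))"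
    using s by (auto simp: cut_sequence_def strict_mono_Suc_iff)
  interpret block_products A "\<lambda>k. s (Suc k)" Lam lam
  proof
    \<comment> \<open>Here \<open>Qprod A s n\<close> starts one cut before the last cut not exceeding \<open>n\<close>, so it contains
      the whole block number \<open>k\<close> and the incomplete one after it.\<close>
    fix k n assume n: "s (Suc (k + 1)) \<le> n" "n < s (Suc (k + 2))"
    then have "cut_index s n = k + 1"
      unfolding cut_index_def using cut_index_ex1[OF s, of n] by (intro the1_equality) auto
    moreover have "s 2 \<le> s (Suc (k + 1))"
      using strict_mono_less_eq[OF mono, of 1 "k + 1"] by (simp add: numeral_2_eq_2)
    ultimately show "mprod A (s (Suc k)) n \<in> H2 Lam \<inter> H3 lam"
      using Q[of n] n by (auto simp: Qprod_def)
  qed (use nonneg nonzero lam Lam mono s in \<open>auto simp: cut_sequence_def\<close>)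
  show ?thesis using directions_converge unfolding direction_def .
qed

end
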